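(* Let $M$ be a closed $3$-manifold with a Riemannian metric, let $f:M\to[0,1]$ be a Morse function, and let $\{\Sigma_t\}_{t\in[0,1]}$, $\Sigma_t=f^{-1}(\{t\})$, be the family of its level sets. Then the smallest saturated set $\Lambda$ containing the family $\{\Sigma_t\}$ has $m_0(\Lambda)>0$.
   Context: $\mathrm{Diff}_0$ is the identity component of the diffeomorphism group of $M$ and $\mathcal{H}^2$ is $2$-dimensional Hausdorff measure. A set of one-parameter families $\{\Sigma_t\}_{t\in[0,1]}$ of subsets of $M$ (surfaces, possibly degenerate at finitely many parameters and finitely many points) is saturated if it is closed under the operation $\{\Sigma_t\}\mapsto\{\psi(t,\Sigma_t)\}$ for every $\psi\in C^\infty([0,1]\times M,M)$ with $\psi(t,\cdot)\in\mathrm{Diff}_0$ for each $t$. Thus the smallest saturated set containing $\{\Sigma_t\}$ is $$\Lambda=\Big\{\{\Gamma_t\}\ :\ \Gamma_t=\psi(t,\Sigma_t)\text{ for some }\psi\in C^\infty([0,1]\times M,M)\text{ with }\psi(t,\cdot)\in\mathrm{Diff}_0\text{ for every }t\Big\}.$$ Moreover $m_0(\Lambda)=\inf_{\{\Gamma_t\}\in\Lambda}\ \max_{t\in[0,1]}\mathcal{H}^2(\Gamma_t)$. *)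

theory Defs
  imports "HOL-Analysis.Analysis"
begin

section \<open>Smooth functions on open subsets of Euclidean spaces\<close>

fun dirderiv :: "'e list \<Rightarrow> ('e::real_normed_vector \<Rightarrow> 'b::real_normed_vector) \<Rightarrow> 'e \<Rightarrow> 'b" where
  "dirderiv [] h = h"
| "dirderiv (v # vs) h = dirderiv vs (\<lambda>x. frechet_derivative h (at x) v)"

text \<open>\<open>C\<^sup>\<infinity>\<close> on the open set \<open>S\<close>; the definition is only meaningful for open \<open>S\<close>.\<close>

definition smooth_on :: "'e::real_normed_vector set \<Rightarrow> ('e \<Rightarrow> 'b::real_normed_vector) \<Rightarrow> bool" where
  "smooth_on S h \<longleftrightarrow> open S \<and> (\<forall>vs. \<forall>x\<in>S. dirderiv vs h differentiable (at x))"

section \<open>Closed manifolds\<close>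

text \<open>A chart is a domain together with a coordinate map, whose values outside the domain are
  irrelevant. An atlas need not be maximal.\<close>

type_synonym ('a, 'e) chart = "'a set \<times> ('a \<Rightarrow> 'e)"

definition chart_image :: "('a, 'e) chart \<Rightarrow> 'e set" where
  "chart_image c = snd c ` fst c"

definition chart_inv :: "('a, 'e) chart \<Rightarrow> 'e \<Rightarrow> 'a" where
  "chart_inv c = inv_into (fst c) (snd c)"

definition smooth_atlas :: "'a::t2_space set \<Rightarrow> ('a, 'e::euclidean_space) chart set \<Rightarrow> bool" where
  "smooth_atlas M A \<longleftrightarrow>
     (\<Union>c\<in>A. fst c) = M \<and>
     (\<forall>c\<in>A. openin (top_of_set M) (fst c) \<and> open (chart_image c) \<and>
        homeomorphism (fst c) (chart_image c) (snd c) (chart_inv c)) \<and>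
     (\<forall>c\<in>A. \<forall>c'\<in>A. smooth_on (snd c ` (fst c \<inter> fst c')) (snd c' \<circ> chart_inv c))"

text \<open>Nonempty, compact, without boundary; Hausdorff by the class constraint. Second countability
  follows from compactness. Connectedness is not required.\<close>

definition closed_manifold :: "'a::t2_space set \<Rightarrow> ('a, 'e::euclidean_space) chart set \<Rightarrow> bool" where
  "closed_manifold M A \<longleftrightarrow> smooth_atlas M A \<and> compact M \<and> M \<noteq> {}"

section \<open>Morse functions\<close>

definition smooth_function :: "('a, 'e::euclidean_space) chart set \<Rightarrow> ('a \<Rightarrow> real) \<Rightarrow> bool" where
  "smooth_function A f \<longleftrightarrow> (\<forall>c\<in>A. smooth_on (chart_image c) (f \<circ> chart_inv c))"

definition critical_point :: "('a, 'e::euclidean_space) chart set \<Rightarrow> ('a \<Rightarrow> real) \<Rightarrow> 'a \<Rightarrow> bool" where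
  "critical_point A f x \<longleftrightarrow>
     (\<forall>c\<in>A. x \<in> fst c \<longrightarrow> (\<forall>v. dirderiv [v] (f \<circ> chart_inv c) (snd c x) = 0))"

definition nondegenerate_hessian :: "('a, 'e::euclidean_space) chart set \<Rightarrow> ('a \<Rightarrow> real) \<Rightarrow> 'a \<Rightarrow> bool" where
  "nondegenerate_hessian A f x \<longleftrightarrow>
     (\<forall>c\<in>A. x \<in> fst c \<longrightarrow>
        (\<forall>u. u \<noteq> 0 \<longrightarrow> (\<exists>v. dirderiv [u, v] (f \<circ> chart_inv c) (snd c x) \<noteq> 0)))"

definition morse_function :: "'a set \<Rightarrow> ('a, 'e::euclidean_space) chart set \<Rightarrow> ('a \<Rightarrow> real) \<Rightarrow> bool" where
  "morse_function M A f \<longleftrightarrow>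
     smooth_function A f \<and> (\<forall>x\<in>M. critical_point A f x \<longrightarrow> nondegenerate_hessian A f x)"

section \<open>Riemannian metrics and 2-dimensional Hausdorff measure\<close>

text \<open>A Riemannian metric is given by its coordinate expressions: \<open>g c y\<close> is the inner product
  on the tangent space at \<open>chart_inv c y\<close>, read in the chart \<open>c\<close>. The last clause is the
  transformation law of a covariant 2-tensor.\<close>

definition riemannian_metric ::
  "('a, 'e::euclidean_space) chart set \<Rightarrow> (('a, 'e) chart \<Rightarrow> 'e \<Rightarrow> 'e \<Rightarrow> 'e \<Rightarrow> real) \<Rightarrow> bool" where
  "riemannian_metric A g \<longleftrightarrow>
     (\<forall>c\<in>A. \<forall>y\<in>chart_image c. bilinear (g c y) \<and> (\<forall>u v. g c y u v = g c y v u) \<and>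
        (\<forall>v. v \<noteq> 0 \<longrightarrow> g c y v v > 0)) \<and>
     (\<forall>c\<in>A. \<forall>u v. smooth_on (chart_image c) (\<lambda>y. g c y u v)) \<and>
     (\<forall>c\<in>A. \<forall>c'\<in>A. \<forall>x\<in>fst c \<inter> fst c'. \<forall>u v.
        g c (snd c x) u v =
        g c' (snd c' x) (frechet_derivative (snd c' \<circ> chart_inv c) (at (snd c x)) u)
                        (frechet_derivative (snd c' \<circ> chart_inv c) (at (snd c x)) v))"

definition piecewise_C1_path ::
  "'a::t2_space set \<Rightarrow> ('a, 'e::euclidean_space) chart set \<Rightarrow> (real \<Rightarrow> 'a) \<Rightarrow> bool" where
  "piecewise_C1_path M A \<gamma> \<longleftrightarrow>
     path \<gamma> \<and> path_image \<gamma> \<subseteq> M \<and>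
     (\<exists>S. finite S \<and>
        (\<forall>c\<in>A. (snd c \<circ> \<gamma>) C1_differentiable_on ({t\<in>{0<..<1}. \<gamma> t \<in> fst c} - S)))"

text \<open>The speed does not depend on the chart chosen, by the transformation law.\<close>

definition riem_speed ::
  "('a, 'e::euclidean_space) chart set \<Rightarrow> (('a, 'e) chart \<Rightarrow> 'e \<Rightarrow> 'e \<Rightarrow> 'e \<Rightarrow> real)
    \<Rightarrow> (real \<Rightarrow> 'a) \<Rightarrow> real \<Rightarrow> real" where
  "riem_speed A g \<gamma> t =
     (let c = (SOME c. c \<in> A \<and> \<gamma> t \<in> fst c); v = vector_derivative (snd c \<circ> \<gamma>) (at t)
      in sqrt (g c (snd c (\<gamma> t)) v v))"

definition riem_length ::
  "('a, 'e::euclidean_space) chart set \<Rightarrow> (('a, 'e) chart \<Rightarrow> 'e \<Rightarrow> 'e \<Rightarrow> 'e \<Rightarrow> real)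
    \<Rightarrow> (real \<Rightarrow> 'a) \<Rightarrow> ennreal" where
  "riem_length A g \<gamma> = (\<integral>\<^sup>+t\<in>{0..1}. ennreal (riem_speed A g \<gamma> t) \<partial>lborel)"

text \<open>The infimum is \<open>\<infinity>\<close> for points in different components.\<close>

definition riem_dist ::
  "'a::t2_space set \<Rightarrow> ('a, 'e::euclidean_space) chart set
    \<Rightarrow> (('a, 'e) chart \<Rightarrow> 'e \<Rightarrow> 'e \<Rightarrow> 'e \<Rightarrow> real) \<Rightarrow> 'a \<Rightarrow> 'a \<Rightarrow> ennreal" where
  "riem_dist M A g x y =
     (INF \<gamma>\<in>{\<gamma>. piecewise_C1_path M A \<gamma> \<and> pathstart \<gamma> = x \<and> pathfinish \<gamma> = y}. riem_length A g \<gamma>)"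

definition ediam :: "('a \<Rightarrow> 'a \<Rightarrow> ennreal) \<Rightarrow> 'a set \<Rightarrow> ennreal" where
  "ediam d S = (SUP x\<in>S. SUP y\<in>S. d x y)"

text \<open>Normalised by the area \<open>pi\<close> of the unit disc.\<close>

definition hausdorff2_delta :: "('a \<Rightarrow> 'a \<Rightarrow> ennreal) \<Rightarrow> ennreal \<Rightarrow> 'a set \<Rightarrow> ennreal" where
  "hausdorff2_delta d \<delta> S =
     (INF C\<in>{C :: nat \<Rightarrow> 'a set. S \<subseteq> (\<Union>i. C i) \<and> (\<forall>i. ediam d (C i) \<le> \<delta>)}.
        \<Sum>i. ennreal pi * (ediam d (C i) / 2) ^ 2)"

definition hausdorff2 :: "('a \<Rightarrow> 'a \<Rightarrow> ennreal) \<Rightarrow> 'a set \<Rightarrow> ennreal" where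
  "hausdorff2 d S = (SUP \<delta>\<in>{0<..}. hausdorff2_delta d \<delta> S)"

section \<open>The identity component of the diffeomorphism group\<close>

definition smooth_map ::
  "'a::t2_space set \<Rightarrow> ('a, 'e::euclidean_space) chart set \<Rightarrow> ('a \<Rightarrow> 'a) \<Rightarrow> bool" where
  "smooth_map M A F \<longleftrightarrow>
     continuous_on M F \<and> F ` M \<subseteq> M \<and>
     (\<forall>c\<in>A. \<forall>c'\<in>A. smooth_on (snd c ` {x \<in> fst c. F x \<in> fst c'}) (snd c' \<circ> F \<circ> chart_inv c))"

text \<open>Diffeomorphisms of \<open>M\<close>, as functions on the ambient type with irrelevant values outside
  \<open>M\<close>.\<close>

definition diffeos :: "'a::t2_space set \<Rightarrow> ('a, 'e::euclidean_space) chart set \<Rightarrow> ('a \<Rightarrow> 'a) set" where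
  "diffeos M A = {F. bij_betw F M M \<and> smooth_map M A F \<and> smooth_map M A (inv_into M F)}"

text \<open>Subbasic neighbourhoods of the \<open>C\<^sup>\<infinity>\<close> topology: closeness to \<open>F\<close> on the compact set \<open>K\<close>,
  in the charts \<open>c\<close> and \<open>c'\<close>, of all partial derivatives of order at most \<open>r\<close>.\<close>

definition diffeo_nbhd ::
  "'a::t2_space set \<Rightarrow> ('a, 'e::euclidean_space) chart set \<Rightarrow> ('a \<Rightarrow> 'a)
    \<Rightarrow> ('a, 'e) chart \<Rightarrow> ('a, 'e) chart \<Rightarrow> 'a set \<Rightarrow> nat \<Rightarrow> real \<Rightarrow> ('a \<Rightarrow> 'a) set" where
  "diffeo_nbhd M A F c c' K r \<epsilon> =
     {G \<in> diffeos M A. G ` K \<subseteq> fst c' \<and>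
        (\<forall>y\<in>snd c ` K. \<forall>vs. set vs \<subseteq> Basis \<and> length vs \<le> r \<longrightarrow>
           norm (dirderiv vs (snd c' \<circ> F \<circ> chart_inv c) y
               - dirderiv vs (snd c' \<circ> G \<circ> chart_inv c) y) < \<epsilon>)}"

definition diffeo_topology ::
  "'a::t2_space set \<Rightarrow> ('a, 'e::euclidean_space) chart set \<Rightarrow> ('a \<Rightarrow> 'a) topology" where
  "diffeo_topology M A = topology_generated_by
     {diffeo_nbhd M A F c c' K r \<epsilon> | F c c' K r \<epsilon>.
        F \<in> diffeos M A \<and> c \<in> A \<and> c' \<in> A \<and> compact K \<and> K \<subseteq> fst c \<and> F ` K \<subseteq> fst c' \<and> 0 < \<epsilon>}"

definition Diff0 :: "'a::t2_space set \<Rightarrow> ('a, 'e::euclidean_space) chart set \<Rightarrow> ('a \<Rightarrow> 'a) set" where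
  "Diff0 M A = connected_component_of_set (diffeo_topology M A) id"

section \<open>Saturated sets and their width\<close>

text \<open>\<open>C\<^sup>\<infinity>([0,1] \<times> M, M)\<close>. Since \<open>[0,1]\<close> has boundary, smoothness means that coordinate
  expressions extend locally to smooth functions on open sets.\<close>

definition smooth_time_map ::
  "'a::t2_space set \<Rightarrow> ('a, 'e::euclidean_space) chart set \<Rightarrow> (real \<Rightarrow> 'a \<Rightarrow> 'a) \<Rightarrow> bool" where
  "smooth_time_map M A \<psi> \<longleftrightarrow>
     (\<forall>t\<in>{0..1}. \<psi> t ` M \<subseteq> M) \<and>
     (\<forall>t\<in>{0..1}. \<forall>c\<in>A. \<forall>x\<in>fst c. \<forall>c'\<in>A. \<psi> t x \<in> fst c' \<longrightarrow>
        (\<exists>W h. (t, snd c x) \<in> W \<and> smooth_on W h \<and>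
           (\<forall>s\<in>{0..1}. \<forall>z\<in>fst c. (s, snd c z) \<in> W \<longrightarrow>
              \<psi> s z \<in> fst c' \<and> h (s, snd c z) = snd c' (\<psi> s z))))"

text \<open>Families are extensional functions on \<open>[0,1]\<close>.\<close>

definition saturated ::
  "'a::t2_space set \<Rightarrow> ('a, 'e::euclidean_space) chart set \<Rightarrow> (real \<Rightarrow> 'a set) set \<Rightarrow> bool" where
  "saturated M A \<Lambda> \<longleftrightarrow>
     \<Lambda> \<subseteq> {0..1} \<rightarrow>\<^sub>E Pow M \<and>
     (\<forall>\<Gamma>\<in>\<Lambda>. \<forall>\<psi>. smooth_time_map M A \<psi> \<and> (\<forall>t\<in>{0..1}. \<psi> t \<in> Diff0 M A) \<longrightarrow>
        (\<lambda>t\<in>{0..1}. \<psi> t ` \<Gamma> t) \<in> \<Lambda>)"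

definition smallest_saturated ::
  "'a::t2_space set \<Rightarrow> ('a, 'e::euclidean_space) chart set \<Rightarrow> (real \<Rightarrow> 'a set) \<Rightarrow> (real \<Rightarrow> 'a set) set" where
  "smallest_saturated M A \<Sigma> = \<Inter>{\<Lambda>. saturated M A \<Lambda> \<and> \<Sigma> \<in> \<Lambda>}"

definition level_family :: "'a set \<Rightarrow> ('a \<Rightarrow> real) \<Rightarrow> real \<Rightarrow> 'a set" where
  "level_family M f = (\<lambda>t\<in>{0..1}. {x \<in> M. f x = t})"

definition width ::
  "'a::t2_space set \<Rightarrow> ('a, 'e::euclidean_space) chart set
    \<Rightarrow> (('a, 'e) chart \<Rightarrow> 'e \<Rightarrow> 'e \<Rightarrow> 'e \<Rightarrow> real) \<Rightarrow> (real \<Rightarrow> 'a set) set \<Rightarrow> ennreal" where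
  "width M A g \<Lambda> = (INF \<Gamma>\<in>\<Lambda>. SUP t\<in>{0..1}. hausdorff2 (riem_dist M A g) (\<Gamma> t))"

lemma saturated_smallest_saturated:
  fixes M :: "'a::t2_space set"
  assumes "\<Sigma> \<in> {0..1} \<rightarrow>\<^sub>E Pow M"
  shows "saturated M A (smallest_saturated M A \<Sigma>)" "\<Sigma> \<in> smallest_saturated M A \<Sigma>"
proof -
  have "saturated M A ({0..1} \<rightarrow>\<^sub>E Pow M)"
    unfolding saturated_def
  proof (intro conjI ballI allI impI)
    fix \<Gamma> :: "real \<Rightarrow> 'a set" and \<psi> :: "real \<Rightarrow> 'a \<Rightarrow> 'a"
    assume \<Gamma>: "\<Gamma> \<in> {0..1} \<rightarrow>\<^sub>E Pow M"
      and \<psi>: "smooth_time_map M A \<psi> \<and> (\<forall>t\<in>{0..1}. \<psi> t \<in> Diff0 M A)"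
    have "\<psi> t ` \<Gamma> t \<in> Pow M" if t: "t \<in> {0..1}" for t
    proof -
      have "\<Gamma> t \<in> Pow M"
        using \<Gamma> t by (rule PiE_mem)
      moreover have "\<psi> t ` M \<subseteq> M"
        using \<psi> t unfolding smooth_time_map_def by blast
      ultimately show ?thesis
        by blast
    qed
    then show "(\<lambda>t\<in>{0..1}. \<psi> t ` \<Gamma> t) \<in> {0..1} \<rightarrow>\<^sub>E Pow M"
      by (rule restrict_PiE_iff[THEN iffD2, rule_format])
  qed simp
  then have "smallest_saturated M A \<Sigma> \<subseteq> {0..1} \<rightarrow>\<^sub>E Pow M"
    using assms unfolding smallest_saturated_def by (intro Inter_lower) simp
  then show "saturated M A (smallest_saturated M A \<Sigma>)"
    unfolding saturated_def[of M A "smallest_saturated M A \<Sigma>"]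
    by (simp add: smallest_saturated_def saturated_def)
  show "\<Sigma> \<in> smallest_saturated M A \<Sigma>"
    by (simp add: smallest_saturated_def)
qed

end

theory Submission
  imports Defs
begin

text \<open>
  Let \<open>Q\<close> be a small cube in a coordinate chart. If \<open>\<Gamma> t = \<psi> t ` \<Sigma> t\<close>, then \<open>\<Gamma> t\<close> is the zero set of
  \<open>G (t, x) = f (inv (\<psi> t) x) - t\<close>, which is jointly continuous, nonnegative for \<open>t = 0\<close> and
  nonpositive for \<open>t = 1\<close>. The volumes of \<open>{G t \<ge> 0}\<close> and \<open>{G t \<le> 0}\<close> in \<open>Q\<close> are upper semicontinuous
  in \<open>t\<close>, so connectedness of \<open>[0,1]\<close> yields a time at which both are at least half the volume of
  \<open>Q\<close>. At that time one of the three coordinate projections of the zero set has area at least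
  \<open>1/6\<close> of a face. Since the Riemannian distance dominates a multiple of the
  Euclidean one at small scale in the chart, this bounds the 2-dimensional Hausdorff measure of
  \<open>\<Gamma> t\<close> from below by a constant depending only on \<open>Q\<close> and the metric.
\<close>

section \<open>Saturation\<close>

lemma smooth_on_differentiable:
  assumes "smooth_on S h" "x \<in> S"
  shows "h differentiable (at x)"
  using assms unfolding smooth_on_def by (metis dirderiv.simps(1))

lemma smooth_on_continuous_on:
  assumes "smooth_on S h"
  shows "continuous_on S h"
  using smooth_on_differentiable[OF assms]
  by (intro continuous_at_imp_continuous_on ballI differentiable_imp_continuous_within)

lemma smooth_atlasD:
  assumes "smooth_atlas M A" "c \<in> A"
  shows "openin (top_of_set M) (fst c)" "open (chart_image c)"
    "homeomorphism (fst c) (chart_image c) (snd c) (chart_inv c)"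
  using assms unfolding smooth_atlas_def by auto

lemma smooth_atlas_transition:
  assumes "smooth_atlas M A" "c \<in> A" "c' \<in> A" "x \<in> fst c \<inter> fst c'"
  shows "(snd c' \<circ> chart_inv c) differentiable (at (snd c x))"
  using assms smooth_on_differentiable[of "snd c ` (fst c \<inter> fst c')" "snd c' \<circ> chart_inv c" "snd c x"]
  unfolding smooth_atlas_def by blast

lemma smooth_atlas_chart:
  assumes "smooth_atlas M A" "x \<in> M"
  obtains c where "c \<in> A" "x \<in> fst c"
  using assms unfolding smooth_atlas_def by blast

lemma continuous_on_openin_cover:
  fixes S :: "'a::t2_space set"
  assumes "\<And>x. x \<in> S \<Longrightarrow> \<exists>U. openin (top_of_set S) U \<and> x \<in> U \<and> continuous_on U f"
  shows "continuous_on S f"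
  unfolding continuous_on_eq_continuous_within
proof (rule ballI)
  fix x assume "x \<in> S"
  then obtain U where U: "openin (top_of_set S) U" "x \<in> U" "continuous_on U f"
    using assms by blast
  then obtain T where T: "open T" "U = S \<inter> T"
    by (auto simp: openin_open)
  then have "at x within U = at x within S"
    using U(2) by (intro at_within_nhd[of x T]) auto
  then show "continuous (at x within S) f"
    using U(2,3) by (auto simp: continuous_on_eq_continuous_within continuous_within)
qed

lemma smooth_function_continuous_on:
  assumes M: "smooth_atlas M A" and f: "smooth_function A f"
  shows "continuous_on M f"
proof (rule continuous_on_openin_cover)
  fix x assume "x \<in> M"
  then obtain c where c: "c \<in> A" "x \<in> fst c"
    using smooth_atlas_chart[OF M] by blast
  note h = smooth_atlasD[OF M c(1)]
  have "continuous_on (chart_image c) (f \<circ> chart_inv c)"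
    using f c unfolding smooth_function_def by (blast intro: smooth_on_continuous_on)
  then have "continuous_on (fst c) (\<lambda>x. (f \<circ> chart_inv c) (snd c x))"
    by (rule continuous_on_compose2) (use h(3) in \<open>auto simp: homeomorphism_def\<close>)
  then have "continuous_on (fst c) f"
    using h(3) by (subst (asm) continuous_on_cong[OF refl, of _ _ f]) (auto simp: homeomorphism_def)
  then show "\<exists>U. openin (top_of_set M) U \<and> x \<in> U \<and> continuous_on U f"
    using h c by blast
qed

text \<open>Near a given point the map is a composite of \<open>snd c\<close> in the space variable,
  the local smooth extension \<open>h\<close>, and \<open>chart_inv c'\<close>. The set
  \<open>N\<close> where this description is valid is relatively open, so continuity of the three
  factors suffices.\<close>

lemma smooth_time_map_continuous_on:
  assumes M: "smooth_atlas M A" and \<psi>: "smooth_time_map M A \<psi>"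
  shows "continuous_on ({0..1} \<times> M) (\<lambda>(t, x). \<psi> t x)"
proof (rule continuous_on_openin_cover)
  fix p assume "p \<in> {0..1::real} \<times> M"
  then obtain t x where p: "p = (t, x)" "t \<in> {0..1}" "x \<in> M"
    by auto
  then have "\<psi> t x \<in> M"
    using \<psi> unfolding smooth_time_map_def by blast
  then obtain c c' where c: "c \<in> A" "x \<in> fst c" "c' \<in> A" "\<psi> t x \<in> fst c'"
    using M p(3) by (metis smooth_atlas_chart)
  then obtain W h where W: "(t, snd c x) \<in> W" "smooth_on W h"
    and h: "\<And>s z. s \<in> {0..1} \<Longrightarrow> z \<in> fst c \<Longrightarrow> (s, snd c z) \<in> W \<Longrightarrow>
       \<psi> s z \<in> fst c' \<and> h (s, snd c z) = snd c' (\<psi> s z)"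
    using \<psi> p(2) unfolding smooth_time_map_def by meson
  note chart = smooth_atlasD[OF M c(1)] and chart' = smooth_atlasD[OF M c(3)]
  define k where "k = (\<lambda>q :: real \<times> 'a. (fst q, snd c (snd q)))"
  define N where "N = ({0..1} \<times> fst c) \<inter> k -` W"
  have "continuous_on (fst c) (snd c)"
    using chart(3) by (rule homeomorphism_cont1)
  then have "continuous_on ({0..1} \<times> fst c) (\<lambda>q. snd c (snd q))"
    by (rule continuous_on_compose2) (auto intro: continuous_on_snd continuous_on_id)
  then have k: "continuous_on ({0..1} \<times> fst c) k"
    unfolding k_def by (intro continuous_intros)
  have "openin (top_of_set ({0..1} \<times> fst c)) N"
    unfolding N_def using W(2)
    by (intro continuous_openin_preimage_gen[OF k]) (simp add: smooth_on_def)
  moreover have "openin (top_of_set ({0..1} \<times> M)) ({0..1} \<times> fst c)"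
    using chart(1) by (intro openin_Times) auto
  ultimately have N: "openin (top_of_set ({0..1} \<times> M)) N"
    by (rule openin_trans)
  have hk: "h (k q) = snd c' (\<psi> (fst q) (snd q))" "\<psi> (fst q) (snd q) \<in> fst c'" if "q \<in> N" for q
    using h[of "fst q" "snd q"] that by (auto simp: N_def k_def)
  have "continuous_on N (\<lambda>q. h (k q))"
    by (rule continuous_on_compose2[OF smooth_on_continuous_on[OF W(2)] continuous_on_subset[OF k]])
      (auto simp: N_def)
  moreover have "(\<lambda>q. h (k q)) ` N \<subseteq> chart_image c'"
    using hk by (auto simp: chart_image_def)
  ultimately have "continuous_on N (\<lambda>q. chart_inv c' (h (k q)))"
    by (rule continuous_on_compose2[OF homeomorphism_cont2[OF chart'(3)]])
  moreover have "chart_inv c' (h (k q)) = (\<lambda>(t, x). \<psi> t x) q" if "q \<in> N" for q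
    using hk[OF that] homeomorphism_apply1[OF chart'(3)] by (simp add: case_prod_unfold)
  ultimately have "continuous_on N (\<lambda>(t, x). \<psi> t x)"
    using continuous_on_cong[OF refl, of N "\<lambda>q. chart_inv c' (h (k q))" "\<lambda>(t, x). \<psi> t x"] by blast
  then show "\<exists>U. openin (top_of_set ({0..1} \<times> M)) U \<and> p \<in> U \<and> continuous_on U (\<lambda>(t, x). \<psi> t x)"
    using N W(1) p c(2) by (intro exI[of _ N]) (auto simp: N_def k_def)
qed

text \<open>A connected component lies in the underlying space of the topology, which is the union
  of the subbasic sets, and each of these consists of diffeomorphisms.\<close>

lemma Diff0_bij_betw:
  assumes "F \<in> Diff0 M A"
  shows "bij_betw F M M"
proof -
  have "F \<in> topspace (diffeo_topology M A)"
    using assms unfolding Diff0_def by (rule subsetD[OF connected_component_of_subset_topspace])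
  then show ?thesis
    unfolding diffeo_topology_def topology_generated_by_topspace
    by (auto simp: diffeo_nbhd_def diffeos_def)
qed

section \<open>Families of zero sets\<close>

text \<open>
  A saturated set that contains the family of level sets and is described without diffeomorphisms;
  it may be larger than the smallest one, but the lower bound already holds on all of it.
\<close>

definition zero_sweepouts :: "'a::t2_space set \<Rightarrow> (real \<Rightarrow> 'a set) set" where
  "zero_sweepouts M = {\<Gamma> \<in> {0..1} \<rightarrow>\<^sub>E Pow M. \<exists>G :: real \<times> 'a \<Rightarrow> real.
     continuous_on ({0..1} \<times> M) G \<and> (\<forall>x\<in>M. 0 \<le> G (0, x) \<and> G (1, x) \<le> 0) \<and>
     (\<forall>t\<in>{0..1}. \<Gamma> t = {x\<in>M. G (t, x) = 0})}"

text \<open>If \<open>\<Gamma> t\<close> is the zero set of \<open>G\<close> at time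
  \<open>t\<close>, its image under \<open>\<psi> t\<close> is the zero set of \<open>G\<close>
  composed with the inverse of \<open>\<psi> t\<close>. The sign conditions at the two ends persist
  because they are imposed at every point of \<open>M\<close>.\<close>

lemma saturated_zero_sweepouts:
  assumes M: "smooth_atlas M A" "compact M"
  shows "saturated M A (zero_sweepouts M)"
  unfolding saturated_def
proof (intro conjI ballI allI impI)
  show "zero_sweepouts M \<subseteq> {0..1} \<rightarrow>\<^sub>E Pow M"
    by (auto simp: zero_sweepouts_def)
next
  fix \<Gamma> :: "real \<Rightarrow> 'a set" and \<psi> :: "real \<Rightarrow> 'a \<Rightarrow> 'a"
  assume "\<Gamma> \<in> zero_sweepouts M"
    and *: "smooth_time_map M A \<psi> \<and> (\<forall>t\<in>{0..1}. \<psi> t \<in> Diff0 M A)"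
  then obtain G :: "real \<times> 'a \<Rightarrow> real" where G: "continuous_on ({0..1} \<times> M) G"
    and G01: "\<And>x. x \<in> M \<Longrightarrow> 0 \<le> G (0, x)" "\<And>x. x \<in> M \<Longrightarrow> G (1, x) \<le> 0"
    and \<Gamma>: "\<And>t. t \<in> {0..1} \<Longrightarrow> \<Gamma> t = {x\<in>M. G (t, x) = 0}"
    unfolding zero_sweepouts_def by blast
  have \<psi>: "bij_betw (\<psi> t) M M" if "t \<in> {0..1}" for t
    using * that by (blast intro: Diff0_bij_betw)
  define \<phi> where "\<phi> = (\<lambda>(t, x). (t, inv_into M (\<psi> t) x))"
  define \<Phi> where "\<Phi> = (\<lambda>q :: real \<times> 'a. (fst q, (\<lambda>(t, x). \<psi> t x) q))"
  have \<phi>: "inv_into M (\<psi> t) x \<in> M" "\<psi> t (inv_into M (\<psi> t) x) = x" if "t \<in> {0..1}" "x \<in> M" for t x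
    using \<psi>[OF that(1)] that(2) by (auto simp: bij_betw_def inv_into_into f_inv_into_f)
  have "continuous_on ({0..1} \<times> M) \<Phi>"
    unfolding \<Phi>_def using smooth_time_map_continuous_on[OF M(1)] * by (intro continuous_intros) blast
  \<comment> \<open>A continuous injection of a compact space into a Hausdorff space has a
    continuous inverse. Applied to \<open>\<Phi>\<close>, this makes the inverses of
    \<open>\<psi> t\<close> continuous jointly in time and space.\<close>
  then have "continuous_on (\<Phi> ` ({0..1} \<times> M)) \<phi>"
    by (rule continuous_on_inv)
      (use M(2) \<psi> in \<open>auto simp: compact_Times \<Phi>_def \<phi>_def bij_betw_def inv_into_f_f\<close>)
  moreover have "\<Phi> ` ({0..1} \<times> M) = {0..1} \<times> M"
  proof -
    have "(t, x) \<in> \<Phi> ` ({0..1} \<times> M)" if "t \<in> {0..1}" "x \<in> M" for t x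
      using \<phi>[OF that] that by (intro image_eqI[of _ _ "(t, inv_into M (\<psi> t) x)"]) (auto simp: \<Phi>_def)
    then show ?thesis
      using \<psi> by (force simp: \<Phi>_def bij_betw_def)
  qed
  ultimately have "continuous_on ({0..1} \<times> M) (\<lambda>q. G (\<phi> q))"
    using \<phi> by (intro continuous_on_compose2[OF G]) (auto simp: \<phi>_def)
  moreover have "\<forall>x\<in>M. 0 \<le> G (\<phi> (0, x)) \<and> G (\<phi> (1, x)) \<le> 0"
    using \<phi> G01 by (auto simp: \<phi>_def)
  moreover have im: "\<psi> t ` \<Gamma> t = {x\<in>M. G (\<phi> (t, x)) = 0}" if t: "t \<in> {0..1}" for t
  proof
    show "\<psi> t ` \<Gamma> t \<subseteq> {x\<in>M. G (\<phi> (t, x)) = 0}"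
      using \<psi>[OF t] by (auto simp: \<Gamma>[OF t] \<phi>_def bij_betw_def inv_into_f_f)
    show "{x\<in>M. G (\<phi> (t, x)) = 0} \<subseteq> \<psi> t ` \<Gamma> t"
    proof
      fix x assume x: "x \<in> {x\<in>M. G (\<phi> (t, x)) = 0}"
      then show "x \<in> \<psi> t ` \<Gamma> t"
        using \<phi>[OF t, of x] by (intro image_eqI[of _ _ "inv_into M (\<psi> t) x"]) (auto simp: \<Gamma>[OF t] \<phi>_def)
    qed
  qed
  ultimately show "(\<lambda>t\<in>{0..1}. \<psi> t ` \<Gamma> t) \<in> zero_sweepouts M"
    unfolding zero_sweepouts_def by (intro CollectI conjI exI[of _ "\<lambda>q. G (\<phi> q)"]) auto
qed

text \<open>At both ends \<open>f x - t\<close> has the required sign because \<open>f\<close> takes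
  its values between 0 and 1.\<close>

lemma level_family_zero_sweepouts:
  assumes "continuous_on M f" "f ` M \<subseteq> {0..1}"
  shows "level_family M f \<in> zero_sweepouts M"
  unfolding zero_sweepouts_def level_family_def
proof (intro CollectI conjI exI[of _ "\<lambda>(t, x). f x - t"])
  show "continuous_on ({0..1} \<times> M) (\<lambda>(t, x). f x - t)"
    unfolding case_prod_unfold
    by (intro continuous_intros continuous_on_compose2[OF assms(1)]) auto
qed (use assms(2) in auto)

section \<open>Bisected cubes\<close>

lemma compact_superlevel:
  fixes h :: "'e::t2_space \<Rightarrow> real"
  assumes "compact K" "continuous_on K h"
  shows "compact {y\<in>K. c \<le> h y}"
proof -
  have "closedin (top_of_set K) (K \<inter> h -` {c..})"
    using assms(2) by (intro continuous_closedin_preimage) auto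
  then show ?thesis
    using assms(1) closedin_compact by (auto simp: vimage_def Int_def)
qed

lemma continuous_on_slice:
  assumes "continuous_on (T \<times> K) G" "t \<in> T"
  shows "continuous_on K (\<lambda>y. G (t, y))"
  by (rule continuous_on_compose2[OF assms(1)]) (use assms(2) in \<open>auto intro!: continuous_intros\<close>)

text \<open>A reverse Fatou argument. The tail unions \<open>B n\<close> decrease, have measure at
  least \<open>m\<close>, and have finite measure inside the compact \<open>K\<close>, so their
  intersection also has measure at least \<open>m\<close>.\<close>

lemma closed_superlevel_emeasure:
  fixes G :: "real \<times> 'e::euclidean_space \<Rightarrow> real"
  assumes T: "closed T" and K: "compact K" and G: "continuous_on (T \<times> K) G"
  shows "closed {t\<in>T. m \<le> emeasure lborel {y\<in>K. 0 \<le> G (t, y)}}"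
  unfolding closed_sequential_limits
proof (intro allI impI, elim conjE)
  fix \<tau> t
  assume \<tau>: "\<forall>n. \<tau> n \<in> {t\<in>T. m \<le> emeasure lborel {y\<in>K. 0 \<le> G (t, y)}}" and lim: "\<tau> \<longlonglongrightarrow> t"
  have t: "t \<in> T"
    using T \<tau> lim closed_sequentially by blast
  define S where "S s = {y\<in>K. 0 \<le> G (s, y)}" for s
  have S: "S s \<in> sets lborel" if "s \<in> T" for s
    unfolding S_def
    using compact_superlevel[OF K continuous_on_slice[OF G that]] by (simp add: borel_compact)
  define B where "B n = (\<Union>k\<in>{n..}. S (\<tau> k))" for n
  have B: "range B \<subseteq> sets lborel"
    using S \<tau> unfolding B_def by blast
  have BK: "B n \<subseteq> K" for n
    by (auto simp: B_def S_def)
  have fin: "emeasure lborel (B n) \<noteq> \<infinity>" for n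
    using emeasure_mono[OF BK[of n], of lborel] emeasure_compact_finite[OF K] K
    by (auto simp: borel_compact top_unique)
  have "m \<le> emeasure lborel (B n)" for n
    using \<tau> B emeasure_mono[of "S (\<tau> n)" "B n" lborel]
    by (auto simp: B_def S_def intro: order_trans)
  then have "m \<le> (INF n. emeasure lborel (B n))"
    by (rule INF_greatest)
  also have "\<dots> = emeasure lborel (\<Inter>n. B n)"
  proof (rule INF_emeasure_decseq[OF B _ fin])
    show "decseq B"
      unfolding decseq_def B_def by (intro allI impI UN_mono) auto
  qed
  also have "\<dots> \<le> emeasure lborel (S t)"
  proof (rule emeasure_mono)
    show "(\<Inter>n. B n) \<subseteq> S t"
    proof
      fix y assume y: "y \<in> (\<Inter>n. B n)"
      then have yK: "y \<in> K"
        using BK by blast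
      \<comment> \<open>A point of every tail union has nonnegative values at arbitrarily late
        times, so the limit of these values cannot be negative.\<close>
      have freq: "\<exists>k\<ge>n. 0 \<le> G (\<tau> k, y)" for n
        using y by (auto simp: B_def S_def)
      have "(\<lambda>n. G (\<tau> n, y)) \<longlonglongrightarrow> G (t, y)"
        using continuous_on_tendsto_compose[OF G, of "\<lambda>n. (\<tau> n, y)" "(t, y)" sequentially] \<tau> lim yK t
        by (simp add: tendsto_Pair)
      from order_tendstoD(2)[OF this, of 0] freq have "\<not> G (t, y) < 0"
        by (meson eventually_sequentially not_less)
      then show "y \<in> S t"
        using yK by (simp add: S_def not_less)
    qed
    show "S t \<in> sets lborel"
      by (rule S[OF t])
  qed
  finally show "t \<in> {t\<in>T. m \<le> emeasure lborel {y\<in>K. 0 \<le> G (t, y)}}"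
    using t by (simp add: S_def)
qed

text \<open>The nonnegative and the nonpositive part cover \<open>K\<close> at each time, so one of
  them has at least half the volume. Hence the closed sets \<open>P\<close> and \<open>N\<close> of
  times cover the interval; they contain 0 and 1 respectively, and connectedness forces them to
  meet.\<close>

lemma bisecting_time:
  fixes G :: "real \<times> 'e::euclidean_space \<Rightarrow> real"
  assumes K: "compact K" "emeasure lborel K = 1" and G: "continuous_on ({0..1} \<times> K) G"
    and G0: "\<And>y. y \<in> K \<Longrightarrow> 0 \<le> G (0, y)" and G1: "\<And>y. y \<in> K \<Longrightarrow> G (1, y) \<le> 0"
  obtains t where "t \<in> {0..1}" "ennreal (1/2) \<le> emeasure lborel {y\<in>K. 0 \<le> G (t, y)}"
    "ennreal (1/2) \<le> emeasure lborel {y\<in>K. 0 \<le> - G (t, y)}"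
proof -
  define P where "P = {t\<in>{0..1}. ennreal (1/2) \<le> emeasure lborel {y\<in>K. 0 \<le> G (t, y)}}"
  define N where "N = {t\<in>{0..1}. ennreal (1/2) \<le> emeasure lborel {y\<in>K. 0 \<le> - G (t, y)}}"
  have G': "continuous_on ({0..1} \<times> K) (\<lambda>x. - G x)"
    using G by (rule continuous_on_minus)
  have P: "closed P" and N: "closed N"
    unfolding P_def N_def
    using closed_superlevel_emeasure[OF _ K(1) G] closed_superlevel_emeasure[OF _ K(1) G'] by simp_all
  have half: "ennreal (1/2) + ennreal (1/2) = 1"
    by (subst ennreal_plus[symmetric]) auto
  have cover: "{0..1} \<subseteq> P \<union> N"
  proof
    fix t :: real assume t: "t \<in> {0..1}"
    let ?P = "{y\<in>K. 0 \<le> G (t, y)}" and ?N = "{y\<in>K. 0 \<le> - G (t, y)}"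
    have "compact ?P" "compact ?N"
      using compact_superlevel[OF K(1) continuous_on_slice[OF G t]]
        compact_superlevel[OF K(1) continuous_on_slice[OF G' t]] by blast+
    then have meas: "?P \<in> sets lborel" "?N \<in> sets lborel"
      unfolding sets_lborel by (blast intro: borel_compact)+
    have "?P \<union> ?N = K"
      by auto
    then have "1 \<le> emeasure lborel ?P + emeasure lborel ?N"
      using emeasure_subadditive[OF meas] K(2) by simp
    then have "\<not> (emeasure lborel ?P < ennreal (1/2) \<and> emeasure lborel ?N < ennreal (1/2))"
      using add_strict_mono[of "emeasure lborel ?P" "ennreal (1/2)" "emeasure lborel ?N" "ennreal (1/2)"]
        half by (auto simp: not_less[symmetric])
    then show "t \<in> P \<union> N"
      using t by (auto simp: P_def N_def not_less)
  qed
  have ends: "0 \<in> P" "1 \<in> N"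
  proof -
    have "{y\<in>K. 0 \<le> G (0, y)} = K" "{y\<in>K. 0 \<le> - G (1, y)} = K"
      using G0 G1 by auto
    moreover have "ennreal (1/2) \<le> 1"
      by (subst ennreal_le_1) simp
    ultimately show "0 \<in> P" "1 \<in> N"
      using K(2) by (simp_all add: P_def N_def)
  qed
  have "P \<inter> N \<inter> {0..1} \<noteq> {}"
  proof
    assume "P \<inter> N \<inter> {0..1} = {}"
    from connected_closedD[OF connected_Icc this cover P N] ends show False
      by (auto simp: disjoint_iff)
  qed
  then show thesis
    using that by (auto simp: P_def N_def)
qed

section \<open>Shadows of the zero set on the faces of a cube\<close>

lemma lborel_Times:
  fixes A :: "'a::euclidean_space set" and B :: "'b::euclidean_space set"
  assumes "A \<in> sets borel" "B \<in> sets borel"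
  shows "A \<times> B \<in> sets borel" "emeasure lborel (A \<times> B) = emeasure lborel A * emeasure lborel B"
proof -
  show "A \<times> B \<in> sets borel"
    using pair_measureI[OF assms] by (metis borel_prod)
  show "emeasure lborel (A \<times> B) = emeasure lborel A * emeasure lborel B"
    using lborel.emeasure_pair_measure_Times[of A lborel B] assms by (simp add: lborel_prod)
qed

text \<open>
  If all three shadows were small, most lines parallel to each axis would miss the zero set. In a
  suitable plane of constant third coordinate \<open>z0\<close>, the good lines in the two directions of the plane
  cross each other, so \<open>G\<close> has the same sign \<open>s\<close> on all of them; spreading along the good lines in
  the third direction, \<open>G\<close> has sign \<open>s\<close> on more than half of the cube.
\<close>

lemma large_shadow:
  fixes G :: "(real \<times> real) \<times> real \<Rightarrow> real"
  defines "Q \<equiv> ({0..1} \<times> {0..1}) \<times> {0..1}"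
  assumes G: "continuous_on Q G"
    and pos: "ennreal (1/2) \<le> emeasure lborel {q\<in>Q. 0 \<le> G q}"
    and neg: "ennreal (1/2) \<le> emeasure lborel {q\<in>Q. 0 \<le> - G q}"
  defines "Z \<equiv> {q\<in>Q. G q = 0}"
  shows "ennreal (1/6) \<le> emeasure lborel ((\<lambda>((x, y), z). (x, y)) ` Z) \<or>
         ennreal (1/6) \<le> emeasure lborel ((\<lambda>((x, y), z). (x, z)) ` Z) \<or>
         ennreal (1/6) \<le> emeasure lborel ((\<lambda>((x, y), z). (y, z)) ` Z)"
proof (rule ccontr)
  define Pz where "Pz = (\<lambda>((x, y), z). (x, y)) ` Z"
  define Py where "Py = (\<lambda>((x, y), z). (x, z)) ` Z"
  define Px where "Px = (\<lambda>((x, y), z). (y, z)) ` Z"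
  assume "\<not> ?thesis"
  then have small: "emeasure lborel Pz < ennreal (1/6)" "emeasure lborel Py < ennreal (1/6)"
    "emeasure lborel Px < ennreal (1/6)"
    by (simp_all add: Px_def Py_def Pz_def not_le)
  have "compact Q"
    unfolding Q_def by (intro compact_Times compact_Icc)
  moreover have "Z = {q\<in>Q. 0 \<le> - \<bar>G q\<bar>}"
    by (auto simp: Z_def)
  ultimately have Z: "compact Z"
    using compact_superlevel[of Q "\<lambda>q. - \<bar>G q\<bar>" 0] G
    by (simp add: continuous_on_minus continuous_on_rabs)
  have cP: "compact Px" "compact Py" "compact Pz"
    unfolding Px_def Py_def Pz_def
    by (auto intro!: compact_continuous_image[OF _ Z] continuous_intros simp: case_prod_unfold)
  have Pmeas: "P \<in> sets (lborel \<Otimes>\<^sub>M lborel)" if "compact P" for P :: "(real \<times> real) set"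
    using that unfolding lborel_prod by (simp add: borel_compact)
  \<comment> \<open>At height \<open>z\<close>, \<open>Bx z\<close> collects the \<open>x\<close>
    whose line parallel to the second axis meets \<open>Z\<close>, and \<open>By z\<close> the
    \<open>y\<close> whose line parallel to the first axis does. These letters name the coordinate
    that is kept; in \<open>Px\<close>, \<open>Py\<close>, \<open>Pz\<close> they name the one
    projected away.\<close>
  define Bx where "Bx z = {x. (x, z) \<in> Py}" for z
  define By where "By z = {y. (y, z) \<in> Px}" for z
  have B: "Bx z \<in> sets lborel" "By z \<in> sets lborel" for z
    using sets_Pair2[OF Pmeas[OF cP(2)], of z] sets_Pair2[OF Pmeas[OF cP(1)], of z]
    by (simp_all add: Bx_def By_def vimage_def)
  have shadow: "emeasure lborel P = (\<integral>\<^sup>+z. emeasure lborel {x. (x, z) \<in> P} \<partial>lborel)"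
    and shadow_measurable: "(\<lambda>z. emeasure lborel {x. (x, z) \<in> P}) \<in> borel_measurable lborel"
    if "compact P" for P :: "(real \<times> real) set"
    using lborel_pair.emeasure_pair_measure_alt2[OF Pmeas[OF that]]
      lborel_pair.measurable_emeasure_Pair2[OF Pmeas[OF that]]
    by (simp_all add: lborel_prod vimage_def)
  \<comment> \<open>Otherwise integration over \<open>z\<close> would give the shadows
    \<open>Px\<close> and \<open>Py\<close> a total area of at least 1/3, against the bound 1/6 +
    1/6.\<close>
  have "\<exists>z0\<in>{0..1}. emeasure lborel (By z0) + emeasure lborel (Bx z0) < ennreal (1/3)"
  proof (rule ccontr)
    assume "\<not> ?thesis"
    then have "ennreal (1/3) * indicator {0..1} z \<le> emeasure lborel (By z) + emeasure lborel (Bx z)" for z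
      by (auto simp: indicator_def not_less)
    then have "(\<integral>\<^sup>+z. ennreal (1/3) * indicator {0..1::real} z \<partial>lborel)
        \<le> (\<integral>\<^sup>+z. emeasure lborel (By z) + emeasure lborel (Bx z) \<partial>lborel)"
      by (intro nn_integral_mono)
    also have "\<dots> = emeasure lborel Px + emeasure lborel Py"
      unfolding shadow[OF cP(1)] shadow[OF cP(2)] Bx_def By_def
      by (intro nn_integral_add shadow_measurable cP)
    also have "\<dots> < ennreal (1/6) + ennreal (1/6)"
      using small by (intro add_strict_mono)
    finally show False
      by (simp add: nn_integral_cmult flip: ennreal_plus)
  qed
  then obtain z0 where z0: "z0 \<in> {0..1}"
    and "emeasure lborel (By z0) + emeasure lborel (Bx z0) < ennreal (1/3)" by blast
  then have Bsmall: "emeasure lborel (By z0) < ennreal (1/3)" "emeasure lborel (Bx z0) < ennreal (1/3)"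
    by (meson add_increasing add_increasing2 le_less_trans order_refl zero_le)+
  have wide: "\<not> {0..1} \<subseteq> S"
    if "S \<in> sets lborel" "emeasure lborel S < ennreal (1/3)" for S :: "real set"
  proof
    assume "{0..1} \<subseteq> S"
    from emeasure_mono[OF this that(1)] have "1 \<le> emeasure lborel S"
      by simp
    also note that(2)
    also have "ennreal (1/3) \<le> 1"
      by (subst ennreal_le_1) simp
    finally show False
      by simp
  qed
  obtain x0 where x0: "x0 \<in> {0..1}" "x0 \<notin> Bx z0"
    using wide[OF B(1) Bsmall(2)] by blast
  obtain y0 where y0: "y0 \<in> {0..1}" "y0 \<notin> By z0"
    using wide[OF B(2) Bsmall(1)] by blast
  \<comment> \<open>\<open>G\<close> has no zero on a segment that avoids \<open>Z\<close>, so the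
    intermediate value theorem preserves its sign. The factor \<open>s\<close>, later 1 or -1,
    treats both signs at once.\<close>
  have same_sign: "0 < s * G q'"
    if s: "0 < s * G q" and p: "\<And>u. u \<in> {0..1} \<Longrightarrow> q + u *\<^sub>R (q' - q) \<in> Q - Z" for s q q'
  proof (rule ccontr)
    assume "\<not> ?thesis"
    moreover have "continuous_on {0..1} (\<lambda>u. s * G (q + u *\<^sub>R (q' - q)))"
      using p by (intro continuous_intros continuous_on_compose2[OF G]) auto
    ultimately obtain u where u: "0 \<le> u" "u \<le> 1" "s * G (q + u *\<^sub>R (q' - q)) = 0"
      using IVT2'[of "\<lambda>u. s * G (q + u *\<^sub>R (q' - q))" 1 0 0] s by auto
    moreover have "s \<noteq> 0"
      using s by auto
    ultimately show False
      using p[of u] by (simp add: Z_def)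
  qed
  have seg: "a + u * (b - a) \<in> {0..1}" if "a \<in> {0..1}" "b \<in> {0..1}" "u \<in> {0..1}" for a b u :: real
    using that convexD_alt[of "{0..1::real}" a b u] by (simp add: algebra_simps)
  \<comment> \<open>From the base point one reaches \<open>((x, y), z)\<close> by moving in
    \<open>y\<close> over \<open>x0\<close>, then in \<open>x\<close>, then in \<open>z\<close>. The
    first move is always free; the others are blocked only if \<open>y\<close> lies in
    \<open>By z0\<close> or \<open>(x, y)\<close> in \<open>Pz\<close>, which costs a volume below
    1/3 + 1/6 = 1/2.\<close>
  have covered: False
    if s: "0 < s * G ((x0, y0), z0)" and big: "ennreal (1/2) \<le> emeasure lborel {q\<in>Q. 0 \<le> - (s * G q)}"
    for s
  proof -
    have "{q\<in>Q. 0 \<le> - (s * G q)} \<subseteq> ({0..1} \<times> By z0) \<times> {0..1} \<union> Pz \<times> {0..1}"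
    proof (rule subsetI, rule ccontr)
      fix q assume q: "q \<in> {q\<in>Q. 0 \<le> - (s * G q)}" "q \<notin> ({0..1} \<times> By z0) \<times> {0..1} \<union> Pz \<times> {0..1}"
      obtain x y z where xyz: "q = ((x, y), z)"
        by (metis surj_pair)
      have y: "y \<notin> By z0" and xy: "(x, y) \<notin> Pz"
        using q by (auto simp: xyz Q_def)
      have Z: "((x0, v), z0) \<notin> Z" "((v, y), z0) \<notin> Z" "((x, y), v) \<notin> Z" for v
        using x0(2) y xy by (force simp: Bx_def By_def Px_def Py_def Pz_def)+
      have I: "x \<in> {0..1}" "y \<in> {0..1}" "z \<in> {0..1}"
        using q(1) by (auto simp: Q_def xyz)
      have "0 < s * G ((x0, y), z0)"
        by (rule same_sign[OF s]) (use Z seg[OF y0(1) I(2)] x0(1) z0 in \<open>simp add: Q_def\<close>)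
      then have "0 < s * G ((x, y), z0)"
        by (rule same_sign) (use Z seg[OF x0(1) I(1)] I z0 in \<open>simp add: Q_def\<close>)
      then have "0 < s * G ((x, y), z)"
        by (rule same_sign) (use Z seg[OF z0 I(3)] I in \<open>simp add: Q_def\<close>)
      then show False
        using q(1) by (simp add: xyz)
    qed
    moreover have sets: "({0..1::real} \<times> By z0) \<times> {0..1::real} \<in> sets lborel" "Pz \<times> {0..1::real} \<in> sets lborel"
      using B(2)[of z0] borel_compact[OF cP(3)] by (simp_all add: lborel_Times)
    ultimately have "emeasure lborel {q\<in>Q. 0 \<le> - (s * G q)}
        \<le> emeasure lborel (({0..1::real} \<times> By z0) \<times> {0..1::real}) + emeasure lborel (Pz \<times> {0..1::real})"
      by (meson emeasure_mono emeasure_subadditive order_trans sets.Un)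
    also have "\<dots> = emeasure lborel (By z0) + emeasure lborel Pz"
      using B(2)[of z0] borel_compact[OF cP(3)] by (simp add: lborel_Times)
    also have "\<dots> < ennreal (1/3) + ennreal (1/6)"
      using small Bsmall by (intro add_strict_mono)
    also have "\<dots> = ennreal (1/2)"
      by (simp flip: ennreal_plus)
    finally show False
      using big by simp
  qed
  have "((x0, y0), z0) \<notin> Z"
    using x0 by (force simp: Bx_def Py_def)
  then have "G ((x0, y0), z0) \<noteq> 0"
    using x0 y0 z0 by (simp add: Z_def Q_def)
  \<comment> \<open>A positive value at the base point contradicts \<open>neg\<close> with
    \<open>s\<close> = 1, a negative one contradicts \<open>pos\<close> with \<open>s\<close> =
    -1.\<close>
  then show False
    using covered[of 1] covered[of "-1"] pos neg by (simp add: neq_iff) linarith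
qed

section \<open>Riemannian distance and Hausdorff measure in a chart\<close>

text \<open>On unit vectors over the compact set \<open>K\<close> the quadratic form attains a
  positive minimum, whose square root serves as \<open>\<kappa>\<close>; homogeneity extends the
  bound to all vectors. An empty \<open>K\<close> has no minimum and is treated apart.\<close>

lemma riemannian_metric_lower_bound:
  fixes A :: "('a, 'e::euclidean_space) chart set"
  assumes g: "riemannian_metric A g" and c: "c \<in> A" and K: "compact K" "K \<subseteq> chart_image c"
  obtains \<kappa> where "0 < \<kappa>" "\<And>y v. y \<in> K \<Longrightarrow> \<kappa> * norm v \<le> sqrt (g c y v v)"
proof (cases "K = {}")
  case True
  then show thesis
    using that[of 1] by simp
next
  case False
  have bil: "bilinear (g c y)" and pd: "v \<noteq> 0 \<Longrightarrow> 0 < g c y v v" if "y \<in> K" for y v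
    using g c K(2) that unfolding riemannian_metric_def by blast+
  have sm: "continuous_on K (\<lambda>y. g c y u v)" for u v
    using g c continuous_on_subset[OF smooth_on_continuous_on K(2)]
    unfolding riemannian_metric_def by blast
  define h where "h = (\<lambda>q. g c (fst q) (snd q) (snd q))"
  \<comment> \<open>The metric is smooth in \<open>y\<close> for fixed vectors. Expanding both
    vectors in the basis turns this into joint continuity in point and vector.\<close>
  have expand: "h q = (\<Sum>(i, j)\<in>Basis \<times> Basis. (snd q \<bullet> i) * (snd q \<bullet> j) * g c (fst q) i j)"
    if "q \<in> K \<times> sphere 0 1" for q
  proof -
    have b: "bilinear (g c (fst q))"
      using that by (auto intro: bil)
    have "h q = g c (fst q) (\<Sum>i\<in>Basis. (snd q \<bullet> i) *\<^sub>R i) (\<Sum>i\<in>Basis. (snd q \<bullet> i) *\<^sub>R i)"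
      by (simp add: h_def euclidean_representation)
    also have "\<dots> = (\<Sum>(i, j)\<in>Basis \<times> Basis. (snd q \<bullet> i) * (snd q \<bullet> j) * g c (fst q) i j)"
      by (subst bilinear_sum[OF b])
        (simp add: bilinear_lmul[OF b] bilinear_rmul[OF b] case_prod_unfold mult_ac)
    finally show ?thesis .
  qed
  have "continuous_on (K \<times> sphere 0 1) (\<lambda>q. g c (fst q) i j)" for i j
    by (rule continuous_on_compose2[OF sm]) (auto intro: continuous_on_fst continuous_on_id)
  then have "continuous_on (K \<times> sphere 0 1)
      (\<lambda>q. \<Sum>ij\<in>Basis \<times> Basis. (snd q \<bullet> fst ij) * (snd q \<bullet> snd ij) * g c (fst q) (fst ij) (snd ij))"
    by (intro continuous_on_sum continuous_on_mult continuous_on_inner continuous_on_snd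
        continuous_on_id continuous_on_const)
  then have "continuous_on (K \<times> sphere 0 1) h"
    by (rule continuous_on_eq) (simp add: expand case_prod_unfold)
  moreover have "compact (K \<times> sphere (0::'e) 1)" "K \<times> sphere (0::'e) 1 \<noteq> {}"
    using K False by (auto simp: compact_Times)
  ultimately obtain q where q: "q \<in> K \<times> sphere 0 1" and min: "\<And>q'. q' \<in> K \<times> sphere 0 1 \<Longrightarrow> h q \<le> h q'"
    using continuous_attains_inf by metis
  have "0 < h q"
    using q pd[of "fst q" "snd q"] by (force simp: h_def)
  show thesis
  proof (rule that[of "sqrt (h q)"])
    show "0 < sqrt (h q)"
      using \<open>0 < h q\<close> by simp
    fix y v assume y: "y \<in> K"
    show "sqrt (h q) * norm v \<le> sqrt (g c y v v)"
    proof (cases "v = 0")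
      case True
      then show ?thesis
        using bilinear_lzero[OF bil[OF y]] by simp
    next
      case False
      define u where "u = v /\<^sub>R norm v"
      have "v = norm v *\<^sub>R u"
        using False by (simp add: u_def)
      then have "g c y v v = g c y (norm v *\<^sub>R u) (norm v *\<^sub>R u)"
        by simp
      also have "\<dots> = (norm v)\<^sup>2 * g c y u u"
        by (simp add: bilinear_lmul[OF bil[OF y]] bilinear_rmul[OF bil[OF y]] power2_eq_square)
      finally have "g c y v v = (norm v)\<^sup>2 * g c y u u" .
      moreover have "h q \<le> g c y u u"
        using min[of "(y, u)"] y False by (simp add: h_def u_def)
      ultimately have "h q * (norm v)\<^sup>2 \<le> g c y v v"
        by (simp add: mult.commute[of "(norm v)\<^sup>2"] mult_right_mono)
      then have "sqrt (h q * (norm v)\<^sup>2) \<le> sqrt (g c y v v)"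
        by (rule real_sqrt_le_mono)
      then show ?thesis
        by (simp add: real_sqrt_mult)
    qed
  qed
qed

text \<open>\<open>riem_speed\<close> picks its chart by \<open>SOME\<close>. The chain rule carries
  the velocity in \<open>c\<close> to the velocity in the chosen chart, and the transformation law
  identifies the two norms.\<close>

lemma riem_speed_chart:
  fixes A :: "('a::t2_space, 'e::euclidean_space) chart set"
  assumes M: "smooth_atlas M A" and g: "riemannian_metric A g" and \<gamma>: "path \<gamma>" "path_image \<gamma> \<subseteq> M"
    and t: "0 < t" "t < 1" and c: "c \<in> A" "\<gamma> t \<in> fst c"
    and v: "((snd c \<circ> \<gamma>) has_vector_derivative v) (at t)"
  shows "riem_speed A g \<gamma> t = sqrt (g c (snd c (\<gamma> t)) v v)"
proof -
  define c' where "c' = (SOME c. c \<in> A \<and> \<gamma> t \<in> fst c)"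
  have c': "c' \<in> A" "\<gamma> t \<in> fst c'"
    using someI[of "\<lambda>c. c \<in> A \<and> \<gamma> t \<in> fst c"] c unfolding c'_def by blast+
  define D where "D = frechet_derivative (snd c' \<circ> chart_inv c) (at (snd c (\<gamma> t)))"
  have D: "((snd c' \<circ> chart_inv c) has_derivative D) (at (snd c (\<gamma> t)))"
    using smooth_atlas_transition[OF M c(1) c'(1)] c(2) c'(2)
    unfolding D_def by (simp add: frechet_derivative_works)
  then have "((snd c' \<circ> chart_inv c) \<circ> (snd c \<circ> \<gamma>) has_vector_derivative D v) (at t)"
    using vector_derivative_diff_chain_within[OF v, of "snd c' \<circ> chart_inv c" D]
    by (simp add: has_derivative_at_withinI)
  moreover obtain U where U: "open U" "fst c = M \<inter> U"
    using smooth_atlasD(1)[OF M c(1)] by (auto simp: openin_open)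
  \<comment> \<open>Since the chart domain is relatively open, the curve stays in it near
    \<open>t\<close>, so the change of coordinates is valid on a neighbourhood, as differentiation
    requires.\<close>
  obtain V where V: "open V" "t \<in> V" "V \<subseteq> {0<..<1}" "\<gamma> ` V \<subseteq> U"
  proof -
    have "continuous_on {0<..<1} \<gamma>"
      using \<gamma>(1) unfolding path_def by (rule continuous_on_subset) auto
    then have "open ({0<..<1} \<inter> \<gamma> -` U)"
      using U(1) by (intro continuous_open_preimage) auto
    then show thesis
      using that[of "{0<..<1} \<inter> \<gamma> -` U"] t c(2) U(2) by auto
  qed
  have "((snd c' \<circ> chart_inv c) \<circ> (snd c \<circ> \<gamma>)) s = (snd c' \<circ> \<gamma>) s" if "s \<in> V" for s
  proof -
    have "\<gamma> s \<in> fst c"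
      using that V \<gamma>(2) U(2) by (auto simp: path_image_def image_subset_iff)
    then show ?thesis
      using smooth_atlasD(3)[OF M c(1)] by (simp add: homeomorphism_def)
  qed
  ultimately have "((snd c' \<circ> \<gamma>) has_vector_derivative D v) (at t)"
    using has_vector_derivative_transform_within_open[OF _ V(1,2)] by blast
  then have "vector_derivative (snd c' \<circ> \<gamma>) (at t) = D v"
    by (rule vector_derivative_at)
  then have "riem_speed A g \<gamma> t = sqrt (g c' (snd c' (\<gamma> t)) (D v) (D v))"
    by (simp add: riem_speed_def c'_def[symmetric] Let_def)
  also have "g c' (snd c' (\<gamma> t)) (D v) (D v) = g c (snd c (\<gamma> t)) v v"
    using g c c' unfolding riemannian_metric_def D_def by (metis IntI)
  finally show ?thesis .
qed

text \<open>The displacement in the chart is the integral of the velocity up to time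
  \<open>b\<close>, and \<open>\<kappa>\<close> times the norm of the velocity is at most the
  Riemannian speed. The part of the curve after \<open>b\<close> can only add length.\<close>

lemma riem_length_ge_chart:
  fixes A :: "('a::t2_space, 'e::euclidean_space) chart set"
  assumes M: "smooth_atlas M A" and g: "riemannian_metric A g" and \<gamma>: "piecewise_C1_path M A \<gamma>"
    and c: "c \<in> A" and b: "0 \<le> b" "b \<le> 1"
    and in_chart: "\<And>t. t \<in> {0..b} \<Longrightarrow> \<gamma> t \<in> fst c \<and> snd c (\<gamma> t) \<in> K"
    and \<kappa>: "0 < \<kappa>" "\<And>y v. y \<in> K \<Longrightarrow> \<kappa> * norm v \<le> sqrt (g c y v v)"
  shows "ennreal (\<kappa> * norm (snd c (\<gamma> b) - snd c (\<gamma> 0))) \<le> riem_length A g \<gamma>"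
proof -
  have path: "path \<gamma>" "path_image \<gamma> \<subseteq> M"
    using \<gamma> by (auto simp: piecewise_C1_path_def)
  obtain S where S: "finite S" "(snd c \<circ> \<gamma>) C1_differentiable_on ({t\<in>{0<..<1}. \<gamma> t \<in> fst c} - S)"
    using \<gamma> c by (auto simp: piecewise_C1_path_def)
  define T where "T = {0<..<b} - S"
  have T: "T \<subseteq> {t\<in>{0<..<1}. \<gamma> t \<in> fst c} - S"
    using b in_chart by (auto simp: T_def)
  obtain D where D: "\<And>t. t \<in> T \<Longrightarrow> ((snd c \<circ> \<gamma>) has_vector_derivative D t) (at t)" "continuous_on T D"
    using S(2) T unfolding C1_differentiable_on_def by (meson continuous_on_subset subsetD)
  \<comment> \<open>Extension by zero makes the velocity a Borel function on the whole line; the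
    finitely many exceptional times do not affect integrals.\<close>
  define v where "v = (\<lambda>t. indicator T t *\<^sub>R D t)"
  have "T \<in> sets borel"
    unfolding T_def using S(1) by (intro borel_open open_Diff finite_imp_closed) auto
  then have v: "v \<in> borel_measurable borel"
    unfolding v_def using D(2) by (rule borel_measurable_continuous_on_indicator)
  have "continuous_on {0..b} (snd c \<circ> \<gamma>)"
  proof (rule continuous_on_compose)
    show "continuous_on {0..b} \<gamma>"
      using path(1) b(2) unfolding path_def by (auto intro: continuous_on_subset)
    show "continuous_on (\<gamma> ` {0..b}) (snd c)"
      using smooth_atlasD(3)[OF M c] in_chart
      by (auto simp: homeomorphism_def intro: continuous_on_subset)
  qed
  then have "(v has_integral (snd c \<circ> \<gamma>) b - (snd c \<circ> \<gamma>) 0) {0..b}"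
    using S(1) b(1) D(1)
    by (intro fundamental_theorem_of_calculus_interior_strong[of S]) (auto simp: v_def T_def simp del: comp_apply)
  then have I: "(v has_integral snd c (\<gamma> b) - snd c (\<gamma> 0)) UNIV"
    unfolding comp_apply by (rule has_integral_on_superset) (auto simp: v_def T_def indicator_def)
  \<comment> \<open>The fundamental theorem gives a gauge integral, which need not converge
    absolutely. If it does not, the right-hand side is infinite.\<close>
  have "norm (snd c (\<gamma> b) - snd c (\<gamma> 0)) \<le> (\<integral>\<^sup>+t. norm (v t) \<partial>lborel)"
  proof (cases "(\<integral>\<^sup>+t. norm (v t) \<partial>lborel) < \<infinity>")
    case True
    then have "integrable lborel v"
      using v by (intro integrableI_bounded) auto
    moreover from this have "integral\<^sup>L lborel v = snd c (\<gamma> b) - snd c (\<gamma> 0)"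
      using I has_integral_unique has_integral_integral_lborel by blast
    ultimately show ?thesis
      using integral_norm_bound_ennreal by metis
  next
    case False
    then show ?thesis
      by (simp add: not_less top_unique)
  qed
  then have "ennreal \<kappa> * norm (snd c (\<gamma> b) - snd c (\<gamma> 0)) \<le> ennreal \<kappa> * (\<integral>\<^sup>+t. norm (v t) \<partial>lborel)"
    by (rule mult_left_mono) simp
  also have "\<dots> = (\<integral>\<^sup>+t. ennreal \<kappa> * norm (v t) \<partial>lborel)"
    using v by (subst nn_integral_cmult) auto
  also have "\<dots> \<le> riem_length A g \<gamma>"
    unfolding riem_length_def
  proof (rule nn_integral_mono)
    fix t
    show "ennreal \<kappa> * norm (v t) \<le> ennreal (riem_speed A g \<gamma> t) * indicator {0..1} t"
    proof (cases "t \<in> T")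
      case True
      then have t: "0 < t" "t < 1" "t \<in> {0..b}"
        using b(2) by (auto simp: T_def)
      then have "riem_speed A g \<gamma> t = sqrt (g c (snd c (\<gamma> t)) (D t) (D t))"
        using in_chart D(1)[OF True] by (intro riem_speed_chart[OF M g path _ _ c]) auto
      then have "\<kappa> * norm (v t) \<le> riem_speed A g \<gamma> t"
        using \<kappa>(2)[of "snd c (\<gamma> t)" "D t"] in_chart[OF t(3)] True by (simp add: v_def)
      then show ?thesis
        using t \<kappa>(1) by (simp add: ennreal_mult[symmetric] ennreal_leI)
    next
      case False
      then show ?thesis
        by (simp add: v_def)
    qed
  qed
  finally show ?thesis
    using \<kappa>(1) by (simp add: ennreal_mult)
qed

text \<open>A path that stays in the ball of radius \<open>R\<close> is at least as long as
  \<open>\<kappa>\<close> times the Euclidean distance of its ends. One that leaves it must first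
  get from the ball of radius \<open>R/2\<close> to the sphere of radius \<open>R\<close>, which
  accounts for the minimum.\<close>

lemma riem_dist_ge_chart:
  fixes A :: "('a::t2_space, 'e::euclidean_space) chart set"
  assumes M: "smooth_atlas M A" and g: "riemannian_metric A g" and c: "c \<in> A"
    and R: "0 < R" "cball p R \<subseteq> chart_image c"
    and \<kappa>: "0 < \<kappa>" "\<And>y v. y \<in> cball p R \<Longrightarrow> \<kappa> * norm v \<le> sqrt (g c y v v)"
    and x: "x \<in> cball p (R/2)" and y: "y \<in> cball p (R/2)"
  shows "ennreal (\<kappa> * min (dist x y) (R/2)) \<le> riem_dist M A g (chart_inv c x) (chart_inv c y)"
  unfolding riem_dist_def
proof (rule INF_greatest, clarify)
  fix \<gamma> assume \<gamma>: "piecewise_C1_path M A \<gamma>" and ends: "pathstart \<gamma> = chart_inv c x" "pathfinish \<gamma> = chart_inv c y"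
  have path: "continuous_on {0..1} \<gamma>" "\<gamma> ` {0..1} \<subseteq> M"
    using \<gamma> by (auto simp: piecewise_C1_path_def path_def path_image_def)
  note chart = smooth_atlasD[OF M c]
  have inv: "snd c (chart_inv c z) = z" "chart_inv c z \<in> fst c" if "z \<in> cball p R" for z
    using homeomorphism_apply2[OF chart(3)] homeomorphism_image2[OF chart(3)] R(2) that by blast+
  have half: "cball p (R/2) \<subseteq> ball p R"
    using R(1) by auto
  define N where "N = chart_inv c ` ball p R"
  define C where "C = chart_inv c ` cball p R"
  have NC: "N \<subseteq> C"
    unfolding N_def C_def by (intro image_mono ball_subset_cball)
  have C: "z \<in> fst c" "snd c z \<in> cball p R" if "z \<in> C" for z
    using that inv by (auto simp: C_def)
  \<comment> \<open>\<open>C\<close> is compact, hence closed in the Hausdorff ambient space; this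
    keeps the path in \<open>C\<close> up to and including the first exit from
    \<open>N\<close>.\<close>
  have "closed C"
    unfolding C_def using chart(3) R(2)
    by (intro compact_imp_closed compact_continuous_image)
      (auto simp: homeomorphism_def intro: continuous_on_subset)
  have "fst c \<inter> snd c -` ball p R \<subseteq> N"
    using homeomorphism_apply1[OF chart(3)] by (force simp: N_def)
  then have "N = fst c \<inter> snd c -` ball p R"
    using inv ball_subset_cball[of p R] by (auto simp: N_def)
  then have "openin (top_of_set (fst c)) N"
    using continuous_openin_preimage_gen[OF homeomorphism_cont1[OF chart(3)] open_ball] by simp
  then have "openin (top_of_set M) N"
    using chart(1) by (rule openin_trans)
  then have opn: "openin (top_of_set {0..1}) ({0..1} \<inter> \<gamma> -` N)"
    using path by (intro continuous_openin_preimage[of _ _ M]) auto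
  define E where "E = {0..1} - ({0..1} \<inter> \<gamma> -` N)"
  have E: "closed E"
    using closedin_diff[OF closedin_subtopology_refl[THEN iffD2] opn]
    by (auto simp: E_def intro: closedin_closed_trans)
  have start: "\<gamma> 0 = chart_inv c x" "snd c (\<gamma> 0) = x" "\<gamma> 0 \<in> N"
    using ends(1) inv(1)[of x] x half by (auto simp: pathstart_def N_def)
  have length: "ennreal (\<kappa> * dist x (snd c (\<gamma> b))) \<le> riem_length A g \<gamma>"
    if "0 \<le> b" "b \<le> 1" "\<gamma> ` {0..b} \<subseteq> C" for b
  proof -
    have "\<gamma> t \<in> fst c \<and> snd c (\<gamma> t) \<in> cball p R" if "t \<in> {0..b}" for t
      using that \<open>\<gamma> ` {0..b} \<subseteq> C\<close> C by blast
    from riem_length_ge_chart[OF M g \<gamma> c that(1,2) this \<kappa>] show ?thesis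
      unfolding start(2) by (simp add: dist_norm norm_minus_commute)
  qed
  show "ennreal (\<kappa> * min (dist x y) (R/2)) \<le> riem_length A g \<gamma>"
  proof (cases "E = {}")
    case True
    then have "\<gamma> ` {0..1} \<subseteq> C"
      using NC by (auto simp: E_def)
    moreover have "snd c (\<gamma> 1) = y"
      using ends(2) inv(1)[of y] y half by (auto simp: pathfinish_def)
    ultimately have "ennreal (\<kappa> * dist x y) \<le> riem_length A g \<gamma>"
      using length[of 1] by simp
    then show ?thesis
      using \<kappa>(1) by (elim order_trans[rotated]) (auto intro!: ennreal_leI mult_left_mono)
  next
    case False
    \<comment> \<open>The first time outside the open ball. The path is in \<open>N\<close> before
      it and therefore in \<open>C\<close> at it, so at time \<open>b\<close> it lies on the sphere
      of radius \<open>R\<close>.\<close>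
    define b where "b = Inf E"
    have bdd: "bdd_below E"
      by (auto simp: E_def)
    have least: "b \<le> t" if "t \<in> E" for t
      unfolding b_def using that bdd by (rule cInf_lower)
    have bE: "b \<in> E"
      unfolding b_def using False bdd E by (rule closed_contains_Inf)
    then have "b \<noteq> 0"
      using start(3) by (auto simp: E_def)
    then have b: "0 < b" "b \<le> 1" "\<gamma> b \<notin> N"
      using bE by (auto simp: E_def)
    have "\<gamma> ` {0..<b} \<subseteq> C"
      using least NC b(2) by (force simp: E_def)
    then have "\<gamma> ` closure {0..<b} \<subseteq> C"
      using path(1) b \<open>closed C\<close>
      by (intro image_closure_subset) (auto intro: continuous_on_subset)
    then have bC: "\<gamma> ` {0..b} \<subseteq> C"
      using b(1) by simp
    then have "\<gamma> b \<in> C"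
      using b(1) by auto
    then have "dist p (snd c (\<gamma> b)) = R"
      using b(3) by (auto simp: C_def N_def inv)
    then have "R/2 \<le> dist x (snd c (\<gamma> b))"
      using x dist_triangle[of p "snd c (\<gamma> b)" x] by simp
    then have "\<kappa> * min (dist x y) (R/2) \<le> \<kappa> * dist x (snd c (\<gamma> b))"
      using \<kappa>(1) by (intro mult_left_mono) auto
    then show ?thesis
      using length[of b] b bC by (meson ennreal_leI less_imp_le order_trans)
  qed
qed

text \<open>By \<open>d\<close>, points at distance \<open>D\<close> < \<open>\<rho>\<close> have
  projections at distance at most \<open>D / k\<close>. So a covering set of diameter
  \<open>D\<close> casts its shadow into a square of side \<open>2 * D / k\<close>, and
  \<open>pi * k\<^sup>2 / 16\<close> is the ratio of its contribution
  \<open>pi * (D / 2)\<^sup>2\<close> to the area of that square.\<close>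

lemma hausdorff2_ge_projection:
  fixes d :: "'a \<Rightarrow> 'a \<Rightarrow> ennreal" and e :: "'q \<Rightarrow> 'a" and \<pi> :: "'q \<Rightarrow> real \<times> real"
  assumes k: "0 < k" "0 < \<rho>"
    and d: "\<And>q q'. q \<in> Z \<Longrightarrow> q' \<in> Z \<Longrightarrow> ennreal (min (k * dist (\<pi> q) (\<pi> q')) \<rho>) \<le> d (e q) (e q')"
    and Z: "e ` Z \<subseteq> S"
  shows "ennreal (pi * k\<^sup>2 / 16) * emeasure lborel (\<pi> ` Z) \<le> hausdorff2 d S"
proof -
  \<comment> \<open>Covers of mesh \<open>\<rho>/2\<close> suffice, the Hausdorff measure being a
    supremum over all meshes. Their diameters are finite and strictly below
    \<open>\<rho>\<close>.\<close>
  have "ennreal (pi * k\<^sup>2 / 16) * emeasure lborel (\<pi> ` Z) \<le> (\<Sum>i. ennreal pi * (ediam d (C i) / 2) ^ 2)"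
    if C: "S \<subseteq> (\<Union>i. C i)" "\<And>i. ediam d (C i) \<le> ennreal (\<rho>/2)" for C :: "nat \<Rightarrow> 'a set"
  proof -
    define D where "D i = enn2real (ediam d (C i))" for i
    have D: "ediam d (C i) = ennreal (D i)" "0 \<le> D i" "D i < \<rho>" for i
    proof -
      have "ediam d (C i) < top"
        using C(2)[of i] by (rule le_less_trans) simp
      then show "ediam d (C i) = ennreal (D i)" "0 \<le> D i"
        by (simp_all add: D_def)
      then show "D i < \<rho>"
        using C(2)[of i] k(2) by (simp add: ennreal_le_iff)
    qed
    define q where "q i = (SOME q. q \<in> Z \<and> e q \<in> C i)" for i
    define r where "r i = D i / k" for i
    define B where "B i = {fst (\<pi> (q i)) - r i .. fst (\<pi> (q i)) + r i} \<times> {snd (\<pi> (q i)) - r i .. snd (\<pi> (q i)) + r i}" for i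
    have r: "0 \<le> r i" for i
      using D k by (simp add: r_def)
    have B: "B i \<in> sets lborel" "emeasure lborel (B i) = ennreal (4 * (r i)\<^sup>2)" for i
      using r[of i] by (simp_all add: B_def lborel_Times ennreal_mult[symmetric] power2_eq_square algebra_simps)
    have "\<pi> ` Z \<subseteq> (\<Union>i. B i)"
    proof
      fix w assume "w \<in> \<pi> ` Z"
      then obtain q' where q': "q' \<in> Z" "w = \<pi> q'"
        by blast
      then obtain i where i: "e q' \<in> C i"
        using C(1) Z by blast
      then have q: "q i \<in> Z" "e (q i) \<in> C i"
        using someI[of "\<lambda>q. q \<in> Z \<and> e q \<in> C i"] q'(1) unfolding q_def by blast+
      have "ennreal (min (k * dist (\<pi> (q i)) (\<pi> q')) \<rho>) \<le> d (e (q i)) (e q')"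
        using q(1) q'(1) by (rule d)
      also have "\<dots> \<le> ediam d (C i)"
        unfolding ediam_def using q(2) i by (meson SUP_upper2 order_refl)
      finally have "k * dist (\<pi> (q i)) (\<pi> q') \<le> D i"
        using D[of i] by (auto simp: ennreal_le_iff min_le_iff_disj)
      then have "dist (\<pi> (q i)) w \<le> r i"
        using k(1) q'(2) by (simp add: r_def field_simps)
      then have "dist (fst (\<pi> (q i))) (fst w) \<le> r i" "dist (snd (\<pi> (q i))) (snd w) \<le> r i"
        using dist_fst_le dist_snd_le order_trans by blast+
      then show "w \<in> (\<Union>i. B i)"
        by (intro UN_I[of i]) (auto simp: B_def dist_real_def mem_Times_iff abs_le_iff)
    qed
    then have "emeasure lborel (\<pi> ` Z) \<le> (\<Sum>i. emeasure lborel (B i))"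
      using B(1) by (intro order_trans[OF emeasure_mono emeasure_subadditive_countably]) auto
    then have "ennreal (pi * k\<^sup>2 / 16) * emeasure lborel (\<pi> ` Z)
        \<le> ennreal (pi * k\<^sup>2 / 16) * (\<Sum>i. ennreal (4 * (r i)\<^sup>2))"
      unfolding B(2) by (rule mult_left_mono) simp
    also have "\<dots> = (\<Sum>i. ennreal (pi * k\<^sup>2 / 16) * ennreal (4 * (r i)\<^sup>2))"
      by simp
    also have "\<dots> = (\<Sum>i. ennreal pi * (ediam d (C i) / 2) ^ 2)"
    proof (intro suminf_cong)
      fix i
      have "ediam d (C i) / 2 = ennreal (D i / 2)"
        using D[of i] by (simp add: divide_ennreal[symmetric])
      then have "ennreal pi * (ediam d (C i) / 2) ^ 2 = ennreal (pi * (D i / 2)\<^sup>2)"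
        using D(2)[of i] by (simp add: ennreal_power ennreal_mult[symmetric])
      also have "pi * (D i / 2)\<^sup>2 = (pi * k\<^sup>2 / 16) * (4 * (r i)\<^sup>2)"
        using k(1) by (simp add: r_def field_simps)
      also have "ennreal \<dots> = ennreal (pi * k\<^sup>2 / 16) * ennreal (4 * (r i)\<^sup>2)"
        by (rule ennreal_mult) auto
      finally show "ennreal (pi * k\<^sup>2 / 16) * ennreal (4 * (r i)\<^sup>2) = ennreal pi * (ediam d (C i) / 2) ^ 2"
        by (rule sym)
    qed
    finally show ?thesis .
  qed
  then have "ennreal (pi * k\<^sup>2 / 16) * emeasure lborel (\<pi> ` Z) \<le> hausdorff2_delta d (ennreal (\<rho>/2)) S"
    unfolding hausdorff2_delta_def by (intro INF_greatest) auto
  also have "\<dots> \<le> hausdorff2 d S"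
    unfolding hausdorff2_def using k(2) by (intro SUP_upper) auto
  finally show ?thesis .
qed

section \<open>The lower bound\<close>

text \<open>Nested pairs make the parameter cube a product of intervals, so that slicing and product
  measures apply. The point \<open>p\<close> is a corner and \<open>s\<close> the side.\<close>

definition cube_map :: "real ^ 3 \<Rightarrow> real \<Rightarrow> (real \<times> real) \<times> real \<Rightarrow> real ^ 3" where
  "cube_map p s = (\<lambda>((x, y), z). p + s *\<^sub>R vector [x, y, z])"

lemma continuous_on_cube_map: "continuous_on S (cube_map p s)"
proof -
  have "continuous_on S (\<lambda>q. vector [fst (fst q), snd (fst q), snd q] :: real ^ 3)"
    unfolding continuous_on_componentwise[where 'b = "real ^ 3"]
    by (auto simp: Basis_vec_def inner_axis forall_3 intro!: continuous_intros)
  then show ?thesis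
    unfolding cube_map_def case_prod_unfold by (intro continuous_intros)
qed

lemma dist_cube_map:
  assumes "0 \<le> s"
  shows "dist (cube_map p s ((x, y), z)) (cube_map p s ((x', y'), z')) =
    s * sqrt ((x - x')\<^sup>2 + (y - y')\<^sup>2 + (z - z')\<^sup>2)"
proof -
  have "cube_map p s ((x, y), z) - cube_map p s ((x', y'), z') = s *\<^sub>R vector [x - x', y - y', z - z']"
    by (simp add: cube_map_def vec_eq_iff forall_3 algebra_simps)
  moreover have "norm (vector [x - x', y - y', z - z'] :: real ^ 3) = sqrt ((x - x')\<^sup>2 + (y - y')\<^sup>2 + (z - z')\<^sup>2)"
    by (simp add: norm_vec_def L2_set_def sum_3)
  ultimately show ?thesis
    using assms by (simp add: dist_norm)
qed

lemma cube_map_in_cball: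
  assumes "0 < s" "q \<in> ({0..1} \<times> {0..1}) \<times> {0..1}"
  shows "cube_map p s q \<in> cball p (2 * s)"
proof -
  obtain x y z where q: "q = ((x, y), z)"
    by (metis surj_pair)
  have "x\<^sup>2 \<le> 1" "y\<^sup>2 \<le> 1" "z\<^sup>2 \<le> 1"
    using assms(2) by (auto simp: q power_le_one)
  \<comment> \<open>The diagonal sqrt 3 of the unit cube is rounded up to 2.\<close>
  then have "sqrt (x\<^sup>2 + y\<^sup>2 + z\<^sup>2) \<le> 2"
    by (intro real_le_lsqrt) auto
  moreover have "cube_map p s ((0, 0), 0) = p"
    by (simp add: cube_map_def vec_eq_iff forall_3)
  then have "dist p (cube_map p s q) = s * sqrt (x\<^sup>2 + y\<^sup>2 + z\<^sup>2)"
    using dist_cube_map[of s p 0 0 0 x y z] assms(1) by (simp add: q)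
  ultimately show ?thesis
    using assms(1) by (simp add: mult.commute)
qed

text \<open>One coordinate cube serves for every sweepout, so \<open>\<epsilon>\<close> is chosen
  before \<open>\<Gamma>\<close> and survives the infimum in the width.\<close>

lemma zero_sweepouts_hausdorff2:
  fixes A :: "('a::t2_space, real ^ 3) chart set"
  assumes M: "closed_manifold M A" and g: "riemannian_metric A g"
  obtains \<epsilon> where "0 < \<epsilon>"
    "\<And>\<Gamma>. \<Gamma> \<in> zero_sweepouts M \<Longrightarrow> \<exists>t\<in>{0..1}. \<epsilon> \<le> hausdorff2 (riem_dist M A g) (\<Gamma> t)"
proof -
  have atlas: "smooth_atlas M A" and "M \<noteq> {}"
    using M by (auto simp: closed_manifold_def)
  then obtain c where c: "c \<in> A" "fst c \<noteq> {}"
    unfolding smooth_atlas_def by blast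
  note chart = smooth_atlasD[OF atlas c(1)]
  obtain p where "p \<in> chart_image c"
    using c(2) by (auto simp: chart_image_def)
  then obtain R where R: "0 < R" "cball p R \<subseteq> chart_image c"
    using chart(2) by (meson open_contains_cball)
  obtain \<kappa> where \<kappa>: "0 < \<kappa>" "\<And>y v. y \<in> cball p R \<Longrightarrow> \<kappa> * norm v \<le> sqrt (g c y v v)"
    using riemannian_metric_lower_bound[OF g c(1) compact_cball R(2)] by blast
  \<comment> \<open>With this side the cube stays within distance \<open>R/2\<close> of
    \<open>p\<close>, the range in which \<open>riem_dist_ge_chart\<close> applies.\<close>
  define s where "s = R / 4"
  define Q where "Q = ({0..1::real} \<times> {0..1::real}) \<times> {0..1::real}"
  define e where "e = (\<lambda>q. chart_inv c (cube_map p s q))"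
  have s: "0 < s"
    using R(1) by (simp add: s_def)
  have Q: "cube_map p s q \<in> cball p (R/2)" if "q \<in> Q" for q
    using cube_map_in_cball[OF s, of q p] that by (simp add: Q_def s_def)
  have QR: "cube_map p s q \<in> chart_image c" if "q \<in> Q" for q
  proof -
    have "cball p (R/2) \<subseteq> cball p R"
      using R(1) by (intro subset_cball) simp
    then show ?thesis
      using Q[OF that] R(2) by blast
  qed
  have "continuous_on Q e"
    unfolding e_def using QR
    by (intro continuous_on_compose2[OF homeomorphism_cont2[OF chart(3)] continuous_on_cube_map]) blast
  have eM: "e q \<in> M" if "q \<in> Q" for q
    using QR[OF that] homeomorphism_image2[OF chart(3)] openin_imp_subset[OF chart(1)]
    unfolding e_def by blast
  \<comment> \<open>The factor of \<open>hausdorff2_ge_projection\<close> for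
    \<open>k = \<kappa> * s\<close>, times the shadow area 1/6 from \<open>large_shadow\<close>.
    Here \<open>s\<close> is the scale of the cube and \<open>\<kappa>\<close> compares the metric
    with the Euclidean one.\<close>
  define \<epsilon> where "\<epsilon> = ennreal (pi * (\<kappa> * s)\<^sup>2 / 16) * ennreal (1/6)"
  have projection: "\<epsilon> \<le> hausdorff2 (riem_dist M A g) S"
    if \<pi>: "\<And>q q'. s * dist (\<pi> q) (\<pi> q') \<le> dist (cube_map p s q) (cube_map p s q')"
      and Z: "Z \<subseteq> Q" "e ` Z \<subseteq> S" and area: "ennreal (1/6) \<le> emeasure lborel (\<pi> ` Z)"
    for \<pi> :: "(real \<times> real) \<times> real \<Rightarrow> real \<times> real" and S Z
  proof -
    have "\<epsilon> \<le> ennreal (pi * (\<kappa> * s)\<^sup>2 / 16) * emeasure lborel (\<pi> ` Z)"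
      unfolding \<epsilon>_def using area by (intro mult_left_mono) simp_all
    also have "\<dots> \<le> hausdorff2 (riem_dist M A g) S"
    proof (rule hausdorff2_ge_projection[OF _ _ _ Z(2)])
      show "0 < \<kappa> * s" "0 < \<kappa> * (R/2)"
        using \<kappa>(1) s R(1) by simp_all
      fix q q' assume "q \<in> Z" "q' \<in> Z"
      then have "cube_map p s q \<in> cball p (R/2)" "cube_map p s q' \<in> cball p (R/2)"
        using Z(1) Q by blast+
      then have "ennreal (\<kappa> * min (dist (cube_map p s q) (cube_map p s q')) (R/2)) \<le> riem_dist M A g (e q) (e q')"
        unfolding e_def by (intro riem_dist_ge_chart[OF atlas g c(1) R \<kappa>(1)] \<kappa>(2))
      moreover have "min (\<kappa> * s * dist (\<pi> q) (\<pi> q')) (\<kappa> * (R/2))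
          = \<kappa> * min (s * dist (\<pi> q) (\<pi> q')) (R/2)"
        using \<kappa>(1) by (simp add: min_def mult.assoc)
      moreover have "\<dots> \<le> \<kappa> * min (dist (cube_map p s q) (cube_map p s q')) (R/2)"
        using \<kappa>(1) \<pi>[of q q'] by (intro mult_left_mono min.mono) auto
      ultimately show "ennreal (min (\<kappa> * s * dist (\<pi> q) (\<pi> q')) (\<kappa> * (R/2))) \<le> riem_dist M A g (e q) (e q')"
        by (metis ennreal_leI order_trans)
    qed
    finally show ?thesis .
  qed
  show thesis
  proof (rule that[of \<epsilon>])
    show "0 < \<epsilon>"
      using \<kappa>(1) s by (simp add: \<epsilon>_def ennreal_mult[symmetric] ennreal_zero_less_mult_iff)
    fix \<Gamma> assume "\<Gamma> \<in> zero_sweepouts M"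
    then obtain G :: "real \<times> 'a \<Rightarrow> real" where G: "continuous_on ({0..1} \<times> M) G"
      and G01: "\<And>x. x \<in> M \<Longrightarrow> 0 \<le> G (0, x)" "\<And>x. x \<in> M \<Longrightarrow> G (1, x) \<le> 0"
      and \<Gamma>: "\<And>t. t \<in> {0..1} \<Longrightarrow> \<Gamma> t = {x\<in>M. G (t, x) = 0}"
      unfolding zero_sweepouts_def by blast
    have "continuous_on ({0..1} \<times> Q) (\<lambda>u. (fst u, e (snd u)))"
      by (intro continuous_on_Pair continuous_on_fst continuous_on_id
          continuous_on_compose2[OF \<open>continuous_on Q e\<close> continuous_on_snd[OF continuous_on_id]]) auto
    then have Ge: "continuous_on ({0..1} \<times> Q) (\<lambda>u. G (fst u, e (snd u)))"
      by (rule continuous_on_compose2[OF G]) (use eM in auto)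
    have "compact Q"
      unfolding Q_def by (intro compact_Times compact_Icc)
    moreover have "emeasure lborel Q = 1"
      by (simp add: Q_def lborel_Times)
    ultimately obtain t where t: "t \<in> {0..1}"
      and half: "ennreal (1/2) \<le> emeasure lborel {q\<in>Q. 0 \<le> G (t, e q)}"
        "ennreal (1/2) \<le> emeasure lborel {q\<in>Q. 0 \<le> - G (t, e q)}"
      using bisecting_time[OF _ _ Ge] G01 eM by auto
    define Z where "Z = {q\<in>Q. G (t, e q) = 0}"
    have "continuous_on Q (\<lambda>q. G (t, e q))"
      using continuous_on_slice[OF Ge t] by simp
    from large_shadow[OF this[unfolded Q_def] half[unfolded Q_def], folded Q_def, folded Z_def]
    have shadows: "ennreal (1/6) \<le> emeasure lborel ((\<lambda>((x, y), z). (x, y)) ` Z) \<or>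
         ennreal (1/6) \<le> emeasure lborel ((\<lambda>((x, y), z). (x, z)) ` Z) \<or>
         ennreal (1/6) \<le> emeasure lborel ((\<lambda>((x, y), z). (y, z)) ` Z)" .
    have Z: "Z \<subseteq> Q" "e ` Z \<subseteq> \<Gamma> t"
      using eM by (auto simp: Z_def \<Gamma>[OF t])
    have contracting: "s * dist (\<pi> q) (\<pi> q') \<le> dist (cube_map p s q) (cube_map p s q')"
      if "\<pi> = (\<lambda>((x, y), z). (x, y)) \<or> \<pi> = (\<lambda>((x, y), z). (x, z)) \<or> \<pi> = (\<lambda>((x, y), z). (y, z))"
      for \<pi> :: "(real \<times> real) \<times> real \<Rightarrow> real \<times> real" and q q'
    proof -
      obtain x y z x' y' z' where q: "q = ((x, y), z)" "q' = ((x', y'), z')"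
        by (metis surj_pair)
      have "dist (\<pi> q) (\<pi> q') \<le> sqrt ((x - x')\<^sup>2 + (y - y')\<^sup>2 + (z - z')\<^sup>2)"
        using that by (auto simp: q dist_Pair_Pair dist_real_def)
      then show ?thesis
        using s by (simp add: q dist_cube_map)
    qed
    obtain \<pi> where \<pi>: "\<pi> = (\<lambda>((x, y), z). (x, y)) \<or> \<pi> = (\<lambda>((x, y), z). (x, z)) \<or> \<pi> = (\<lambda>((x, y), z). (y, z))"
      "ennreal (1/6) \<le> emeasure lborel (\<pi> ` Z)"
      using shadows by blast
    have "\<epsilon> \<le> hausdorff2 (riem_dist M A g) (\<Gamma> t)"
      by (rule projection[OF contracting[OF \<pi>(1)] Z \<pi>(2)])
    then show "\<exists>t\<in>{0..1}. \<epsilon> \<le> hausdorff2 (riem_dist M A g) (\<Gamma> t)"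
      using t by blast
  qed
qed

theorem proposition1p4:
  fixes M :: "'a::t2_space set"
    and A :: "('a, real ^ 3) chart set"
    and g :: "('a, real ^ 3) chart \<Rightarrow> real ^ 3 \<Rightarrow> real ^ 3 \<Rightarrow> real ^ 3 \<Rightarrow> real"
    and f :: "'a \<Rightarrow> real"
  assumes "closed_manifold M A"
    and "riemannian_metric A g"
    and "morse_function M A f"
    and "f ` M \<subseteq> {0..1}"
  shows "0 < width M A g (smallest_saturated M A (level_family M f))"
proof -
  have M: "smooth_atlas M A" "compact M"
    using assms(1) by (auto simp: closed_manifold_def)
  have "continuous_on M f"
    using assms(3) by (intro smooth_function_continuous_on[OF M(1)]) (simp add: morse_function_def)
  \<comment> \<open>The smallest saturated set is an intersection, and
    \<open>zero_sweepouts M\<close> is one of the sets intersected.\<close>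
  then have sub: "smallest_saturated M A (level_family M f) \<subseteq> zero_sweepouts M"
    unfolding smallest_saturated_def
    using saturated_zero_sweepouts[OF M] level_family_zero_sweepouts[OF _ assms(4)] by blast
  obtain \<epsilon> where \<epsilon>: "0 < \<epsilon>"
    "\<And>\<Gamma>. \<Gamma> \<in> zero_sweepouts M \<Longrightarrow> \<exists>t\<in>{0..1}. \<epsilon> \<le> hausdorff2 (riem_dist M A g) (\<Gamma> t)"
    using zero_sweepouts_hausdorff2[OF assms(1,2)] by blast
  have "\<epsilon> \<le> width M A g (smallest_saturated M A (level_family M f))"
    unfolding width_def
  proof (rule INF_greatest)
    fix \<Gamma> assume "\<Gamma> \<in> smallest_saturated M A (level_family M f)"
    then show "\<epsilon> \<le> (SUP t\<in>{0..1}. hausdorff2 (riem_dist M A g) (\<Gamma> t))"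
      using sub \<epsilon>(2)[of \<Gamma>] by (meson SUP_upper2 subsetD)
  qed
  with \<epsilon>(1) show ?thesis
    by (rule less_le_trans)
qed

end
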